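(* Let $n,p\in\{1,2,3,\ldots\}$, let $A,B\in\mathbb{R}^{p\times n}$ with $\operatorname{rank}(A\ B)=p$, and let $G:\mathbb{R}^n\rightrightarrows\mathbb{R}^n$ be the linear relation with $\operatorname{gra} G=\{(x,x^* )\in\mathbb{R}^n\times\mathbb{R}^n\mid Ax+Bx^*=0\}$. Assume that $G$ is monotone. Then $(x,x^* )\in\operatorname{gra}G$ if and only if $$x=\tfrac12\big[\mathrm{Id}+(B-A)^{\dagger}(B+A)\big]y,\qquad x^*=\tfrac12\big[\mathrm{Id}-(B-A)^{\dagger}(B+A)\big]y$$ for $y=x+x^*\in\operatorname{ran}(\mathrm{Id}+G)$, where the Moore–Penrose inverse is $(B-A)^{\dagger}=[(B-A)^{\intercal}(B-A)]^{-1}(B-A)^{\intercal}$. In particular, when $G$ is maximally monotone, $$\operatorname{gra}G=\{((B-A)^{-1}By,\,-(B-A)^{-1}Ay)\mid y\in\mathbb{R}^n\}.$$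
   Context: $\mathbb{R}^n$ carries the Euclidean inner product $\langle\cdot,\cdot\rangle$. A set-valued operator $T:\mathbb{R}^n\rightrightarrows\mathbb{R}^n$ is identified with its graph $\operatorname{gra}T=\{(x,x^* )\mid x^*\in Tx\}$; it is a linear relation if $\operatorname{gra}T$ is a linear subspace. $T$ is monotone if $\langle x-y,x^*-y^*\rangle\ge0$ for all $(x,x^* ),(y,y^* )\in\operatorname{gra}T$, and maximally monotone if it is monotone and has no proper monotone extension (in the sense of graph inclusion, among all set-valued operators). $\operatorname{ran}(\mathrm{Id}+G)=\{a+a^*\mid(a,a^* )\in\operatorname{gra}G\}$. (When $G$ is monotone, $B-A$ has full column rank $n$, so $(B-A)^{\intercal}(B-A)$ is invertible; when $G$ is maximally monotone, $p=n$ and $B-A$ is an invertible square matrix.) *)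

theory Defs
  imports "HOL-Analysis.Analysis"
begin

type_synonym ('a, 'b) set_valued = "'a \<Rightarrow> 'b set"

definition gra :: "('a, 'b) set_valued \<Rightarrow> ('a \<times> 'b) set" where
  "gra T = {(x, x'). x' \<in> T x}"

definition linear_relation :: "('a::real_vector, 'b::real_vector) set_valued \<Rightarrow> bool" where
  "linear_relation T \<longleftrightarrow> subspace (gra T)"

definition monotone_operator :: "('a::real_inner, 'a) set_valued \<Rightarrow> bool" where
  "monotone_operator T \<longleftrightarrow>
     (\<forall>(x, x') \<in> gra T. \<forall>(y, y') \<in> gra T. (x - y) \<bullet> (x' - y') \<ge> 0)"

definition maximally_monotone_operator :: "('a::real_inner, 'a) set_valued \<Rightarrow> bool" where
  "maximally_monotone_operator T \<longleftrightarrow>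
     monotone_operator T \<and>
     \<not> (\<exists>S. monotone_operator S \<and> gra T \<subset> gra S)"

definition ran_Id_plus :: "('a::plus, 'a) set_valued \<Rightarrow> 'a set" where
  "ran_Id_plus T = {a + a' | a a'. (a, a') \<in> gra T}"

text \<open>The block matrix \<open>(A B)\<close>: its columns are indexed by the disjoint sum of
  the column indices of \<open>A\<close> and \<open>B\<close>.\<close>

definition block_row :: "'a^'n^'p \<Rightarrow> 'a^'m^'p \<Rightarrow> 'a^('n + 'm)^'p" where
  "block_row A B = (\<chi> i j. case j of Inl k \<Rightarrow> A $ i $ k | Inr k \<Rightarrow> B $ i $ k)"

definition is_moore_penrose :: "real^'n^'m \<Rightarrow> real^'m^'n \<Rightarrow> bool" where
  "is_moore_penrose M X \<longleftrightarrow>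
     M ** X ** M = M \<and>
     X ** M ** X = X \<and>
     transpose (M ** X) = M ** X \<and>
     transpose (X ** M) = X ** M"

lemma is_moore_penrose_unique:
  assumes X: "is_moore_penrose M X" and Y: "is_moore_penrose M Y"
  shows "X = Y"
proof -
  have MX: "M ** X = M ** Y"
  proof -
    have "M ** X = transpose (M ** Y ** (M ** X))"
      using X Y unfolding is_moore_penrose_def by (metis matrix_mul_assoc)
    also have "\<dots> = M ** X ** (M ** Y)"
      using X Y unfolding is_moore_penrose_def by (metis matrix_transpose_mul)
    also have "\<dots> = M ** Y"
      using X unfolding is_moore_penrose_def by (metis matrix_mul_assoc)
    finally show ?thesis .
  qed
  have XM: "X ** M = Y ** M"
  proof -
    have "X ** M = transpose (X ** M ** (Y ** M))"
      using X Y unfolding is_moore_penrose_def by (metis matrix_mul_assoc)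
    also have "\<dots> = Y ** M ** (X ** M)"
      using X Y unfolding is_moore_penrose_def by (metis matrix_transpose_mul)
    also have "\<dots> = Y ** M"
      using X unfolding is_moore_penrose_def by (metis matrix_mul_assoc)
    finally show ?thesis .
  qed
  show ?thesis
    using X Y MX XM unfolding is_moore_penrose_def by (metis matrix_mul_assoc)
qed

definition moore_penrose :: "real^'n^'m \<Rightarrow> real^'m^'n" where
  "moore_penrose M = (THE X. is_moore_penrose M X)"

lemma moore_penrose_eqI: "is_moore_penrose M X \<Longrightarrow> moore_penrose M = X"
  unfolding moore_penrose_def using is_moore_penrose_unique by blast

end

theory Submission
  imports Defs
begin

text \<open>In the coordinates \<open>y = x + x'\<close> and \<open>d = x - x'\<close> the equation \<open>A x + B x' = 0\<close> reads
  \<open>(B - A) d = (B + A) y\<close>, and monotonicity makes \<open>B - A\<close> injective; so \<open>d\<close> is recovered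
  from \<open>y\<close> by the Moore--Penrose inverse. If \<open>G\<close> is maximal then \<open>y\<close> ranges over the whole space:
  otherwise one could add to the graph the pairs \<open>(u, u)\<close> with \<open>u\<close> orthogonal to
  \<open>ran (Id + G)\<close>. Hence the range of \<open>B - A\<close> contains that of \<open>B + A\<close>, so those of \<open>A\<close> and \<open>B\<close>,
  and is everything by the rank condition.\<close>

lemma block_row_mult_vector:
  fixes A :: "real^'n^'p" and B :: "real^'m^'p"
  shows "block_row A B *v w = A *v (\<chi> k. w $ Inl k) + B *v (\<chi> k. w $ Inr k)"
proof -
  have "(\<Sum>j\<in>UNIV. f j) = (\<Sum>k\<in>UNIV. f (Inl k)) + (\<Sum>k\<in>UNIV. f (Inr k))"
    for f :: "'n + 'm \<Rightarrow> real"
    by (simp add: sum.Plus UNIV_Plus_UNIV[symmetric] del: UNIV_Plus_UNIV)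
  then show ?thesis
    by (simp add: vec_eq_iff block_row_def matrix_vector_mult_def)
qed

text \<open>This is the form in which the rank condition enters later: full row rank makes the block
  matrix surjective, and a preimage splits into its two blocks \<open>u\<close> and
  \<open>v\<close>.\<close>

lemma full_rank_block_rowE:
  fixes A :: "real^'n^'p" and B :: "real^'m^'p"
  assumes "rank (block_row A B) = CARD('p)"
  obtains u v where "z = A *v u + B *v v"
proof -
  obtain w where "z = block_row A B *v w"
    using assms unfolding full_rank_surjective by blast
  then show ?thesis
    using that unfolding block_row_mult_vector by blast
qed

lemma matrix_vector_mult_minus_right:
  fixes M :: "real^'n^'m"
  shows "M *v (- x) = - (M *v x)"
  by (rule linear_neg[OF matrix_vector_mul_linear])

lemma matrix_inv_invertible:
  fixes M :: "real^'n^'m"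
  assumes "invertible M"
  shows "M ** matrix_inv M = mat 1" and "matrix_inv M ** M = mat 1"
  using someI_ex[OF assms[unfolded invertible_def]] by (simp_all add: matrix_inv_def)

text \<open>Since the squared norm of \<open>M *v u\<close> is the inner product of
  \<open>(transpose M ** M) *v u\<close> with \<open>u\<close>, the square Gram matrix has the same
  trivial kernel as \<open>M\<close>.\<close>

lemma invertible_gram_matrix:
  fixes M :: "real^'n^'m"
  assumes "inj ((*v) M)"
  shows "invertible (transpose M ** M)"
proof -
  have "u = 0" if "(transpose M ** M) *v u = 0" for u
  proof -
    have "(M *v u) \<bullet> (M *v u) = ((transpose M ** M) *v u) \<bullet> u"
      by (simp add: matrix_vector_mul_assoc[symmetric] dot_lmul_matrix)
    then have "M *v u = M *v 0"
      using that by simp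
    then show "u = 0"
      using assms by (meson injD)
  qed
  then show ?thesis
    by (simp add: invertible_left_inverse matrix_left_invertible_ker)
qed

text \<open>By uniqueness it suffices to check the four Penrose equations for
  \<open>N ** transpose M\<close>. It is a left inverse of \<open>M\<close>, which settles three of
  them; symmetry of \<open>M ** N ** transpose M\<close> comes from symmetry of
  \<open>N\<close>.\<close>

lemma moore_penrose_full_column_rank:
  fixes M :: "real^'n^'m"
  assumes "invertible (transpose M ** M)"
  shows "moore_penrose M = matrix_inv (transpose M ** M) ** transpose M"
    and "moore_penrose M ** M = mat 1"
proof -
  define S where "S = transpose M ** M"
  define N where "N = matrix_inv S"
  have NS: "N ** S = mat 1" and SN: "S ** N = mat 1"
    using assms by (simp_all add: S_def N_def matrix_inv_invertible)
  have "transpose S = S"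
    by (simp add: S_def matrix_transpose_mul)
  \<comment> \<open>Transposing \<open>S ** N = mat 1\<close> shows that \<open>transpose N\<close>
    is a left inverse of \<open>S\<close>; it must equal the right inverse \<open>N\<close>.\<close>
  then have "transpose N ** S = mat 1"
    using SN by (metis matrix_transpose_mul transpose_mat)
  then have NT: "transpose N = N"
    by (metis SN matrix_mul_assoc matrix_mul_lid matrix_mul_rid)
  have XM: "(N ** transpose M) ** M = mat 1"
    using NS by (simp add: S_def matrix_mul_assoc[symmetric])
  have "is_moore_penrose M (N ** transpose M)"
    unfolding is_moore_penrose_def XM
    by (simp add: matrix_mul_assoc[symmetric] XM[simplified matrix_mul_assoc[symmetric]]
        matrix_transpose_mul NT)
  then have "moore_penrose M = N ** transpose M"
    by (rule moore_penrose_eqI)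
  then show "moore_penrose M = matrix_inv (transpose M ** M) ** transpose M"
    and "moore_penrose M ** M = mat 1"
    using XM by (simp_all add: N_def S_def)
qed

text \<open>The rows and columns of \<open>M\<close> have different index types, so a two-sided
  inverse is assembled from a left and a right one: \<open>L = L ** M ** R = R\<close>.\<close>

lemma invertible_if_inj_surj:
  fixes M :: "real^'n^'m"
  assumes "inj ((*v) M)" and "surj ((*v) M)"
  shows "invertible M"
proof -
  obtain L R where L: "L ** M = mat 1" and R: "M ** R = mat 1"
    using assms
    by (metis matrix_left_invertible_injective matrix_right_invertible_surjective)
  then have "L = R"
    by (metis matrix_mul_assoc matrix_mul_lid matrix_mul_rid)
  with L R show ?thesis
    unfolding invertible_def by blast
qed

text \<open>The surjectivity half of Minty's theorem for linear relations. The range is a subspace,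
  so it is enough that only \<open>0\<close> is orthogonal to it.\<close>

lemma maximally_monotone_linear_ran:
  fixes G :: "('a::euclidean_space, 'a) set_valued"
  assumes lin: "linear_relation G" and max: "maximally_monotone_operator G"
  shows "ran_Id_plus G = UNIV"
proof -
  have sub: "subspace (gra G)"
    using lin by (simp add: linear_relation_def)
  have mono: "monotone_operator G"
    using max by (simp add: maximally_monotone_operator_def)
  have nonneg: "a \<bullet> a' \<ge> 0" if "(a, a') \<in> gra G" for a a'
    using mono that subspace_0[OF sub]
    unfolding monotone_operator_def zero_prod_def by fastforce
  have "ran_Id_plus G = (\<lambda>p. fst p + snd p) ` gra G"
    by (force simp: ran_Id_plus_def)
  then have subR: "subspace (ran_Id_plus G)"
    using sub
    by (auto intro!: linear_subspace_image bounded_linear.linear bounded_linear_add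
        bounded_linear_fst bounded_linear_snd)
  have zero: "u = 0" if orth: "\<And>y. y \<in> ran_Id_plus G \<Longrightarrow> u \<bullet> y = 0" for u
  proof -
    \<comment> \<open>The graph of \<open>S\<close> is \<open>gra G\<close> plus the line spanned by
      \<open>(u, u)\<close>.\<close>
    define S where "S x = {x'. \<exists>c. (x - c *\<^sub>R u, x' - c *\<^sub>R u) \<in> gra G}" for x
    have gS: "(x, x') \<in> gra S \<longleftrightarrow> (\<exists>c. (x - c *\<^sub>R u, x' - c *\<^sub>R u) \<in> gra G)" for x x'
      by (simp add: gra_def S_def)
    have "monotone_operator S"
      unfolding monotone_operator_def
    proof clarify
      fix x x' y y' assume "(x, x') \<in> gra S" "(y, y') \<in> gra S"
      then obtain b c where "(x - b *\<^sub>R u, x' - b *\<^sub>R u) \<in> gra G"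
        and "(y - c *\<^sub>R u, y' - c *\<^sub>R u) \<in> gra G"
        unfolding gS by blast
      from subspace_diff[OF sub this]
      obtain a a' e where aa: "(a, a') \<in> gra G" and "x - y = a + e *\<^sub>R u" "x' - y' = a' + e *\<^sub>R u"
        by (auto intro!: that[of "x - y - (b - c) *\<^sub>R u" "x' - y' - (b - c) *\<^sub>R u" "b - c"]
            simp: algebra_simps)
      \<comment> \<open>The cross terms add up to \<open>e * (u \<bullet> (a + a'))\<close>, which
        vanishes by orthogonality and leaves two nonnegative terms.\<close>
      moreover have "u \<bullet> (a + a') = 0"
        using aa by (intro orth) (auto simp: ran_Id_plus_def)
      then have "(a + e *\<^sub>R u) \<bullet> (a' + e *\<^sub>R u) = a \<bullet> a' + e\<^sup>2 * (u \<bullet> u)"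
        by (simp add: inner_commute inner_add_left inner_add_right power2_eq_square
            flip: distrib_left)
      ultimately show "(x - y) \<bullet> (x' - y') \<ge> 0"
        using nonneg[OF aa] by simp
    qed
    moreover have "gra G \<subseteq> gra S"
    proof clarify
      fix x x' assume "(x, x') \<in> gra G"
      then show "(x, x') \<in> gra S"
        unfolding gS by (intro exI[of _ 0]) simp
    qed
    ultimately have "gra S = gra G"
      using max unfolding maximally_monotone_operator_def by blast
    \<comment> \<open>Shifting \<open>(0, 0)\<close> by \<open>c = 1\<close> gives
      \<open>(u, u)\<close>, so by maximality \<open>u + u\<close> lies in the range and
      \<open>u\<close> is orthogonal to it.\<close>
    moreover have "(u, u) \<in> gra S"
      unfolding gS using subspace_0[OF sub] by (intro exI[of _ 1]) (simp add: zero_prod_def)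
    ultimately have "u + u \<in> ran_Id_plus G"
      by (auto simp: ran_Id_plus_def)
    from orth[OF this] show "u = 0"
      by (simp add: inner_add_right)
  qed
  show ?thesis
  proof (rule ccontr)
    assume "ran_Id_plus G \<noteq> UNIV"
    then have "span (ran_Id_plus G) \<subset> UNIV"
      by (simp only: span_eq_iff[THEN iffD2, OF subR] psubset_eq subset_UNIV simp_thms)
    then obtain u where "u \<noteq> 0" "\<And>y. y \<in> span (ran_Id_plus G) \<Longrightarrow> orthogonal u y"
      by (metis span_UNIV orthogonal_to_subspace_exists_gen)
    then show False
      using zero[of u] by (auto simp: orthogonal_def span_base)
  qed
qed

theorem theorem4p2:
  fixes A B :: "real^'n^'p"
    and G :: "(real^'n, real^'n) set_valued"
  assumes "rank (block_row A B) = CARD('p)"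
    and "linear_relation G"
    and "gra G = {(x, x'). A *v x + B *v x' = 0}"
    and "monotone_operator G"
  shows "invertible (transpose (B - A) ** (B - A)) \<and>
    moore_penrose (B - A) = matrix_inv (transpose (B - A) ** (B - A)) ** transpose (B - A) \<and>
    (\<forall>x x'. (x, x') \<in> gra G \<longleftrightarrow>
       (\<exists>y \<in> ran_Id_plus G. y = x + x' \<and>
          x = ((1/2) *\<^sub>R (mat 1 + moore_penrose (B - A) ** (B + A))) *v y \<and>
          x' = ((1/2) *\<^sub>R (mat 1 - moore_penrose (B - A) ** (B + A))) *v y)) \<and>
    (maximally_monotone_operator G \<longrightarrow>
       CARD('p) = CARD('n) \<and> invertible (B - A) \<and>
       gra G = {(matrix_inv (B - A) *v (B *v y), - (matrix_inv (B - A) *v (A *v y))) | y. True})"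
proof (intro conjI impI)
  let ?M = "B - A"
  have memG: "(x, x') \<in> gra G \<longleftrightarrow> A *v x + B *v x' = 0" for x x'
    by (simp add: assms(3))
  \<comment> \<open>A kernel vector puts \<open>(- u, u)\<close> into the graph; monotonicity
    against \<open>(0, 0)\<close> then says that minus the squared norm of \<open>u\<close> is
    nonnegative.\<close>
  have "u = 0" if "?M *v u = 0" for u
  proof -
    have "(- u, u) \<in> gra G" "(0, 0) \<in> gra G"
      using that by (simp_all add: memG matrix_vector_mult_diff_rdistrib
          matrix_vector_mult_minus_right)
    then have "(- u - 0) \<bullet> (u - 0) \<ge> 0"
      using assms(4) unfolding monotone_operator_def by blast
    then show "u = 0"
      using inner_ge_zero[of u] by simp
  qed
  then have inj: "inj ((*v) ?M)"
    by (simp add: linear_injective_0)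
  then show inv: "invertible (transpose ?M ** ?M)"
    by (rule invertible_gram_matrix)
  then show "moore_penrose ?M = matrix_inv (transpose ?M ** ?M) ** transpose ?M"
    by (rule moore_penrose_full_column_rank)
  let ?X = "moore_penrose ?M"
  \<comment> \<open>The two sides differ by twice \<open>A *v x + B *v x'\<close>.\<close>
  have diff: "?M *v (x - x') = (B + A) *v (x + x')" if "(x, x') \<in> gra G" for x x'
  proof -
    have "B *v x' = - (A *v x)"
      using that by (simp add: memG add_eq_0_iff)
    then show ?thesis
      by (simp add: matrix_vector_mult_diff_rdistrib matrix_vector_mult_add_rdistrib
          matrix_vector_mult_diff_distrib matrix_vector_right_distrib)
  qed
  let ?P = "(1/2) *\<^sub>R (mat 1 + ?X ** (B + A))"
  let ?Q = "(1/2) *\<^sub>R (mat 1 - ?X ** (B + A))"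
  \<comment> \<open>With \<open>y = x + x'\<close> and \<open>d = x - x'\<close>, the pair is half
    of \<open>y + d\<close> and half of \<open>y - d\<close>; the left inverse \<open>?X\<close>
    turns \<open>diff\<close> into a formula for \<open>d\<close>.\<close>
  have formulas: "x = ?P *v (x + x')" "x' = ?Q *v (x + x')" if "(x, x') \<in> gra G" for x x'
  proof -
    have "(?X ** (B + A)) *v (x + x') = ?X *v (?M *v (x - x'))"
      by (simp only: matrix_vector_mul_assoc[symmetric] diff[OF that])
    also have "\<dots> = x - x'"
      by (simp add: matrix_vector_mul_assoc moore_penrose_full_column_rank(2)[OF inv])
    finally have d: "(?X ** (B + A)) *v (x + x') = x - x'" .
    have "?P *v (x + x') = (1/2) *\<^sub>R ((x + x') + (x - x'))"
      unfolding scaleR_matrix_vector_assoc[symmetric] matrix_vector_mult_add_rdistrib d by simp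
    moreover have "?Q *v (x + x') = (1/2) *\<^sub>R ((x + x') - (x - x'))"
      unfolding scaleR_matrix_vector_assoc[symmetric] matrix_vector_mult_diff_rdistrib d by simp
    ultimately show "x = ?P *v (x + x')" "x' = ?Q *v (x + x')"
      by (simp_all add: scaleR_2[symmetric])
  qed
  show "\<forall>x x'. (x, x') \<in> gra G \<longleftrightarrow>
    (\<exists>y \<in> ran_Id_plus G. y = x + x' \<and> x = ?P *v y \<and> x' = ?Q *v y)"
  proof (intro allI iffI)
    fix x x' assume "(x, x') \<in> gra G"
    then show "\<exists>y \<in> ran_Id_plus G. y = x + x' \<and> x = ?P *v y \<and> x' = ?Q *v y"
      using formulas[of x x'] by (auto simp: ran_Id_plus_def)
  next
    \<comment> \<open>Membership of \<open>y\<close> in the range supplies a graph pair with sum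
      \<open>y\<close>; the formulas depend on \<open>y\<close> alone, so they return exactly that
      pair.\<close>
    fix x x' assume "\<exists>y \<in> ran_Id_plus G. y = x + x' \<and> x = ?P *v y \<and> x' = ?Q *v y"
    then obtain a a' where aa: "(a, a') \<in> gra G"
      and "x = ?P *v (a + a')" "x' = ?Q *v (a + a')"
      unfolding ran_Id_plus_def by blast
    then have "x = a" "x' = a'"
      using formulas[OF aa] by simp_all
    with aa show "(x, x') \<in> gra G"
      by simp
  qed
  assume max: "maximally_monotone_operator G"
  have onto: "\<exists>x x'. (x, x') \<in> gra G \<and> y = x + x'" for y
    using maximally_monotone_linear_ran[OF assms(2) max] unfolding ran_Id_plus_def by blast
  \<comment> \<open>Replacing \<open>B *v x'\<close> by \<open>- (A *v x)\<close> puts both images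
    of the sum into the range of \<open>?M\<close>. This serves surjectivity and the final
    parametrization.\<close>
  have split: "B *v (x + x') = ?M *v x" "A *v (x + x') = - (?M *v x')"
    if "(x, x') \<in> gra G" for x x'
  proof -
    have "B *v x' = - (A *v x)"
      using that by (simp add: memG add_eq_0_iff)
    then show "B *v (x + x') = ?M *v x" "A *v (x + x') = - (?M *v x')"
      by (simp_all add: matrix_vector_mult_diff_rdistrib matrix_vector_right_distrib)
  qed
  have "\<exists>w. z = ?M *v w" for z
  proof -
    obtain u v where z: "z = A *v u + B *v v"
      using full_rank_block_rowE[OF assms(1)] by blast
    obtain a a' b b' where a: "(a, a') \<in> gra G" "u = a + a'" and b: "(b, b') \<in> gra G" "v = b + b'"
      using onto by meson
    \<comment> \<open>By \<open>split\<close>, \<open>A *v u\<close> is \<open>- (?M *v a')\<close>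
      and \<open>B *v v\<close> is \<open>?M *v b\<close>.\<close>
    have "z = ?M *v (b - a')"
      unfolding z a(2) b(2) split[OF a(1)] split[OF b(1)]
      by (simp add: matrix_vector_mult_diff_distrib)
    then show ?thesis ..
  qed
  then have surj: "surj ((*v) ?M)"
    by (auto simp: surj_def)
  have "DIM(real^'p) = DIM(real^'n)"
    using dim_image_eq[of "(*v) ?M" UNIV] inj surj by simp
  then show "CARD('p) = CARD('n)"
    by simp
  show invM: "invertible ?M"
    using inj surj by (rule invertible_if_inj_surj)
  have cancel: "matrix_inv ?M *v (?M *v w) = w" for w
    using invM by (simp add: matrix_vector_mul_assoc matrix_inv_invertible)
  have pair: "(x, x') = (matrix_inv ?M *v (B *v (x + x')), - (matrix_inv ?M *v (A *v (x + x'))))"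
    if "(x, x') \<in> gra G" for x x'
    unfolding split[OF that] by (simp add: cancel matrix_vector_mult_minus_right)
  show "gra G = {(matrix_inv ?M *v (B *v y), - (matrix_inv ?M *v (A *v y))) | y. True}"
    (is "_ = ?R")
  proof
    show "gra G \<subseteq> ?R"
    proof clarify
      fix x x' assume "(x, x') \<in> gra G"
      from pair[OF this] show "\<exists>y. (x, x') =
          (matrix_inv ?M *v (B *v y), - (matrix_inv ?M *v (A *v y))) \<and> True"
        by blast
    qed
    show "?R \<subseteq> gra G"
    \<comment> \<open>Every \<open>y\<close> is the sum of a graph pair, and \<open>pair\<close>
      identifies that pair with the one built from \<open>y\<close>.\<close>
    proof clarify
      fix y
      obtain x x' where G: "(x, x') \<in> gra G" and "y = x + x'"
        using onto by blast
      with pair[OF G] show "(matrix_inv ?M *v (B *v y), - (matrix_inv ?M *v (A *v y))) \<in> gra G"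
        by simp
    qed
  qed
qed

end
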